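(* Let $G=(V,\mathcal D,\ell_v)$ and $G'=(V',\mathcal D',\ell'_v)$ be finite node-labeled digraphs that are simple. Then $\operatorname{aDMCES}(G,G')=\operatorname{DMCES}(G,G')$.
   Context: A node-labeled digraph $G=(V,\mathcal D,\ell_v)$ consists of a finite node set $V$, directed edges $\mathcal D\subseteq V\times V$, and a node-labeling function $\ell_v$ on $V$. Simple: no self-loops and no parallel edges with the same source and target. DMCES: a feasible solution is a pair $(U,\phi)$ with $U\subseteq V$ and $\phi:U\to V'$ injective with $\ell'_v(\phi(u))=\ell_v(u)$ for all $u\in U$; its score is $\mathcal P(U,\phi)=\sum_{(v_1,v_2)\in U\times U}\epsilon(v_1,v_2)\epsilon'(\phi(v_1),\phi(v_2))$, where $\epsilon(v_1,v_2)=1$ if $(v_1,v_2)\in\mathcal D$ and $0$ otherwise, and similarly $\epsilon'$ for $\mathcal D'$; $\operatorname{DMCES}(G,G')$ is the maximum score over feasible solutions. aDMCES: for $W\subseteq\mathcal D$, the $W$ edge-induced subgraph of $G$ is $(U_W,W,\ell_v|_{U_W})$ with $U_W$ the set of endpoints of edges in $W$; $\operatorname{aDMCES}(G,G')$ is the maximum of $|W|$ over pairs $W\subseteq\mathcal D$, $W'\subseteq\mathcal D'$ whose edge-induced subgraphs are isomorphic as node-labeled digraphs (isomorphism: label-preserving bijection of node sets mapping edges to edges and non-edges to non-edges). *)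

theory Defs
  imports "Graph_Theory.Pair_Digraph" "HOL-Library.FuncSet"
begin

text \<open>
  Arcs are pairs of nodes, so parallel arcs are excluded by the representation; for the
  underlying graph, \<^term>\<open>pair_digraph\<close> says that it is well-formed (arcs join nodes of the
  graph), finite and without self-loops. Only the labels of nodes of the graph are meaningful.
\<close>

record ('a, 'l) labeled_digraph =
  graph :: "'a pair_pre_digraph"
  label :: "'a \<Rightarrow> 'l"

abbreviation nodes :: "('a, 'l) labeled_digraph \<Rightarrow> 'a set" where
  "nodes G \<equiv> pverts (graph G)"

abbreviation edges :: "('a, 'l) labeled_digraph \<Rightarrow> ('a \<times> 'a) set" where
  "edges G \<equiv> parcs (graph G)"

definition simple_labeled_digraph :: "('a, 'l) labeled_digraph \<Rightarrow> bool" where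
  "simple_labeled_digraph G \<longleftrightarrow> pair_digraph (graph G)"

definition edge_ind :: "('a, 'l) labeled_digraph \<Rightarrow> 'a \<Rightarrow> 'a \<Rightarrow> nat" where
  "edge_ind G v\<^sub>1 v\<^sub>2 = (if (v\<^sub>1, v\<^sub>2) \<in> edges G then 1 else 0)"

definition dmces_feasible ::
    "('a, 'l) labeled_digraph \<Rightarrow> ('b, 'l) labeled_digraph \<Rightarrow> ('a set \<times> ('a \<Rightarrow> 'b)) set" where
  "dmces_feasible G G' = {(U, \<phi>). U \<subseteq> nodes G \<and> \<phi> \<in> U \<rightarrow>\<^sub>E nodes G' \<and> inj_on \<phi> U \<and>
     (\<forall>u\<in>U. label G' (\<phi> u) = label G u)}"

definition dmces_score ::
    "('a, 'l) labeled_digraph \<Rightarrow> ('b, 'l) labeled_digraph \<Rightarrow> 'a set \<Rightarrow> ('a \<Rightarrow> 'b) \<Rightarrow> nat" where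
  "dmces_score G G' U \<phi> =
     (\<Sum>(v\<^sub>1, v\<^sub>2) \<in> U \<times> U. edge_ind G v\<^sub>1 v\<^sub>2 * edge_ind G' (\<phi> v\<^sub>1) (\<phi> v\<^sub>2))"

definition DMCES :: "('a, 'l) labeled_digraph \<Rightarrow> ('b, 'l) labeled_digraph \<Rightarrow> nat" where
  "DMCES G G' = Max {dmces_score G G' U \<phi> | U \<phi>. (U, \<phi>) \<in> dmces_feasible G G'}"

definition edge_induced_subgraph ::
    "('a, 'l) labeled_digraph \<Rightarrow> ('a \<times> 'a) set \<Rightarrow> ('a, 'l) labeled_digraph" where
  "edge_induced_subgraph G W =
     \<lparr>graph = \<lparr>pverts = fst ` W \<union> snd ` W, parcs = W\<rparr>,
      label = restrict (label G) (fst ` W \<union> snd ` W)\<rparr>"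

definition labeled_digraph_isomorphic ::
    "('a, 'l) labeled_digraph \<Rightarrow> ('b, 'l) labeled_digraph \<Rightarrow> bool" where
  "labeled_digraph_isomorphic H H' \<longleftrightarrow>
     (\<exists>f. bij_betw f (nodes H) (nodes H') \<and>
        (\<forall>u\<in>nodes H. label H' (f u) = label H u) \<and>
        (\<forall>u\<in>nodes H. \<forall>v\<in>nodes H. (u, v) \<in> edges H \<longleftrightarrow> (f u, f v) \<in> edges H'))"

definition aDMCES :: "('a, 'l) labeled_digraph \<Rightarrow> ('b, 'l) labeled_digraph \<Rightarrow> nat" where
  "aDMCES G G' = Max {card W | W W'. W \<subseteq> edges G \<and> W' \<subseteq> edges G' \<and>
     labeled_digraph_isomorphic (edge_induced_subgraph G W) (edge_induced_subgraph G' W')}"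

text \<open>
  The arguments of \<^term>\<open>Max\<close> above are finite and non-empty, so that it is a genuine maximum.
\<close>

lemma finite_dmces_feasible:
  assumes "simple_labeled_digraph G" "simple_labeled_digraph G'"
  shows "finite (dmces_feasible G G')"
proof -
  have fin: "finite (nodes G)" "finite (nodes G')"
    using assms
    by (auto simp: simple_labeled_digraph_def pair_digraph_def pair_fin_digraph_def
        pair_fin_digraph_axioms_def)
  have "dmces_feasible G G' \<subseteq> (SIGMA U:Pow (nodes G). U \<rightarrow>\<^sub>E nodes G')"
    by (auto simp: dmces_feasible_def)
  moreover have "finite (SIGMA U:Pow (nodes G). U \<rightarrow>\<^sub>E nodes G')"
    using fin by (intro finite_SigmaI finite_PiE) (auto intro: finite_subset)
  ultimately show ?thesis by (rule finite_subset)
qed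

lemma dmces_scores_finite_nonempty:
  assumes "simple_labeled_digraph G" "simple_labeled_digraph G'"
  shows "finite {dmces_score G G' U \<phi> | U \<phi>. (U, \<phi>) \<in> dmces_feasible G G'}"
    and "{dmces_score G G' U \<phi> | U \<phi>. (U, \<phi>) \<in> dmces_feasible G G'} \<noteq> {}"
proof -
  have "{dmces_score G G' U \<phi> | U \<phi>. (U, \<phi>) \<in> dmces_feasible G G'}
      = (\<lambda>(U, \<phi>). dmces_score G G' U \<phi>) ` dmces_feasible G G'" by force
  then show "finite {dmces_score G G' U \<phi> | U \<phi>. (U, \<phi>) \<in> dmces_feasible G G'}"
    using finite_dmces_feasible[OF assms] by simp
  have "({}, \<lambda>_. undefined) \<in> dmces_feasible G G'" by (simp add: dmces_feasible_def)
  then show "{dmces_score G G' U \<phi> | U \<phi>. (U, \<phi>) \<in> dmces_feasible G G'} \<noteq> {}" by blast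
qed

lemma admces_sizes_finite_nonempty:
  fixes G :: "('a, 'l) labeled_digraph" and G' :: "('b, 'l) labeled_digraph"
  assumes "simple_labeled_digraph G"
  defines "S \<equiv> {card W | W W'. W \<subseteq> edges G \<and> W' \<subseteq> edges G' \<and>
     labeled_digraph_isomorphic (edge_induced_subgraph G W) (edge_induced_subgraph G' W')}"
  shows "finite S" and "S \<noteq> {}"
proof -
  have fin: "finite (edges G)"
    using assms(1)
    by (auto simp: simple_labeled_digraph_def pair_digraph_def pair_fin_digraph_def
        pair_fin_digraph_axioms_def)
  have "S \<subseteq> card ` Pow (edges G)" by (auto simp: S_def)
  then show "finite S" using fin by (auto intro: finite_subset)
  have "labeled_digraph_isomorphic (edge_induced_subgraph G {}) (edge_induced_subgraph G' {})"
    by (simp add: labeled_digraph_isomorphic_def edge_induced_subgraph_def bij_betw_def)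
  then have "card ({} :: ('a \<times> 'a) set) \<in> S" unfolding S_def by blast
  then show "S \<noteq> {}" by blast
qed

end

theory Submission
  imports Defs
begin

text \<open>
  The score of a feasible pair \<open>(U, \<phi>)\<close> counts the set \<open>W\<close> of edges inside \<open>U\<close> that \<open>\<phi>\<close> maps to
  edges, and \<open>\<phi>\<close> is an isomorphism between the subgraphs induced by \<open>W\<close> and by its image.
  Conversely, an isomorphism between the subgraphs induced by \<open>W\<close> and \<open>W'\<close> is a feasible solution
  on the endpoints of \<open>W\<close>. Its score is at least \<open>card W\<close>, but may be larger, since edges outside
  \<open>W\<close> can also be preserved. Hence the two sets of attained values need not agree elementwise,
  but each value in one is dominated by a value in the other.
\<close>

definition preserved_edges ::
    "('a, 'l) labeled_digraph \<Rightarrow> ('b, 'l) labeled_digraph \<Rightarrow> 'a set \<Rightarrow> ('a \<Rightarrow> 'b) \<Rightarrow> ('a \<times> 'a) set" where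
  "preserved_edges G G' U \<phi> = {(u, v) \<in> U \<times> U. (u, v) \<in> edges G \<and> (\<phi> u, \<phi> v) \<in> edges G'}"

text \<open>A product of two 0/1 indicators is the indicator of both conditions, so the sum counts
  pairs. Finiteness of \<open>U\<close> matters: a sum over an infinite set is 0 by
  convention.\<close>

lemma dmces_score_eq_card_preserved_edges:
  assumes "finite U"
  shows "dmces_score G G' U \<phi> = card (preserved_edges G G' U \<phi>)"
proof -
  have "dmces_score G G' U \<phi> = (\<Sum>e \<in> U \<times> U. if e \<in> preserved_edges G G' U \<phi> then 1 else 0)"
    unfolding dmces_score_def preserved_edges_def edge_ind_def
    by (intro sum.cong) (auto split: if_splits)
  also have "\<dots> = card ((U \<times> U) \<inter> preserved_edges G G' U \<phi>)"
    using assms by (simp add: sum.If_cases)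
  also have "(U \<times> U) \<inter> preserved_edges G G' U \<phi> = preserved_edges G G' U \<phi>"
    by (auto simp: preserved_edges_def)
  finally show ?thesis .
qed

lemma simple_labeled_digraphD:
  assumes "simple_labeled_digraph G"
  shows "finite (nodes G)" and "W \<subseteq> edges G \<Longrightarrow> fst ` W \<union> snd ` W \<subseteq> nodes G"
proof -
  interpret pair_digraph "graph G"
    using assms by (simp add: simple_labeled_digraph_def)
  show "finite (nodes G)" by simp
  show "fst ` W \<union> snd ` W \<subseteq> nodes G" if "W \<subseteq> edges G"
    using that by (intro Un_least image_subsetI arc_fst_in_verts arc_snd_in_verts) blast+
qed

text \<open>Since \<open>\<phi>\<close> is injective on \<open>U\<close>, which contains all
  endpoints of \<open>W\<close>, a pair of endpoints outside \<open>W\<close> cannot land on the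
  image of an edge of \<open>W\<close>; so non-edges go to non-edges.\<close>

lemma preserved_edges_isomorphic_image:
  assumes "(U, \<phi>) \<in> dmces_feasible G G'"
  defines "W \<equiv> preserved_edges G G' U \<phi>"
  shows "labeled_digraph_isomorphic (edge_induced_subgraph G W)
           (edge_induced_subgraph G' (map_prod \<phi> \<phi> ` W))"
proof -
  let ?N = "fst ` W \<union> snd ` W" and ?W' = "map_prod \<phi> \<phi> ` W"
  have NU: "?N \<subseteq> U" by (auto simp: W_def preserved_edges_def)
  have inj: "inj_on \<phi> U" and lab: "\<forall>u\<in>U. label G' (\<phi> u) = label G u"
    using assms(1) by (auto simp: dmces_feasible_def)
  have img: "\<phi> ` ?N = fst ` ?W' \<union> snd ` ?W'" by (force simp: image_Un image_image)
  have "bij_betw \<phi> ?N (fst ` ?W' \<union> snd ` ?W')"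
    unfolding bij_betw_def using img inj_on_subset[OF inj NU] by simp
  \<comment> \<open>Induced subgraphs carry restricted labels, so the original labels are recovered
    only once \<open>u\<close> and \<open>\<phi> u\<close> are known to be endpoints.\<close>
  moreover have "restrict (label G') (fst ` ?W' \<union> snd ` ?W') (\<phi> u) = restrict (label G) ?N u"
    if "u \<in> ?N" for u
  proof -
    have "\<phi> u \<in> fst ` ?W' \<union> snd ` ?W'" using that img by blast
    then show ?thesis using that NU lab by (simp only: restrict_apply' subset_eq)
  qed
  moreover have "(u, v) \<in> W \<longleftrightarrow> (\<phi> u, \<phi> v) \<in> ?W'" if "u \<in> ?N" "v \<in> ?N" for u v
  proof
    assume "(\<phi> u, \<phi> v) \<in> ?W'"
    then obtain a b where ab: "(a, b) \<in> W" "\<phi> a = \<phi> u" "\<phi> b = \<phi> v" by auto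
    then have "a \<in> U" "b \<in> U" by (auto simp: W_def preserved_edges_def)
    with ab that NU inj have "a = u" "b = v" by (auto dest: inj_onD)
    with ab show "(u, v) \<in> W" by simp
  qed (auto intro: rev_image_eqI)
  ultimately show ?thesis
    unfolding labeled_digraph_isomorphic_def edge_induced_subgraph_def
    by (intro exI[of _ \<phi>]) simp
qed

text \<open>The endpoints of \<open>W\<close> serve as \<open>U\<close> and the isomorphism as
  \<open>\<phi>\<close>: edges of \<open>W\<close> go to edges of \<open>W'\<close>, hence of
  \<open>G'\<close>.\<close>

lemma isomorphism_feasible:
  assumes "simple_labeled_digraph G" "simple_labeled_digraph G'"
    and "W \<subseteq> edges G" "W' \<subseteq> edges G'"
    and "labeled_digraph_isomorphic (edge_induced_subgraph G W) (edge_induced_subgraph G' W')"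
  obtains U \<phi> where "(U, \<phi>) \<in> dmces_feasible G G'" "W \<subseteq> preserved_edges G G' U \<phi>"
proof -
  define N N' where "N = fst ` W \<union> snd ` W" and "N' = fst ` W' \<union> snd ` W'"
  have N: "N \<subseteq> nodes G" "N' \<subseteq> nodes G'"
    using simple_labeled_digraphD(2) assms(1-4) unfolding N_def N'_def by blast+
  obtain f where bij: "bij_betw f N N'"
    and lab: "\<forall>u\<in>N. restrict (label G') N' (f u) = restrict (label G) N u"
    and edge: "\<forall>u\<in>N. \<forall>v\<in>N. (u, v) \<in> W \<longleftrightarrow> (f u, f v) \<in> W'"
    using assms(5) unfolding labeled_digraph_isomorphic_def edge_induced_subgraph_def N_def N'_def
    by auto
  have fN: "f u \<in> N'" if "u \<in> N" for u using bij that by (auto simp: bij_betw_def)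
  \<comment> \<open>Feasible maps are extensional, so \<open>f\<close> is made
    \<open>undefined\<close> outside \<open>N\<close>.\<close>
  have "inj_on (restrict f N) N" using bij by (simp add: bij_betw_def inj_on_def)
  moreover have "restrict f N \<in> N \<rightarrow>\<^sub>E nodes G'" using fN N by auto
  moreover have "\<forall>u\<in>N. label G' (restrict f N u) = label G u" using lab fN by simp
  ultimately have "(N, restrict f N) \<in> dmces_feasible G G'"
    using N by (simp add: dmces_feasible_def)
  moreover have "W \<subseteq> preserved_edges G G' N (restrict f N)"
  proof
    fix e assume "e \<in> W"
    moreover obtain u v where "e = (u, v)" by fastforce
    moreover from calculation have "u \<in> N" "v \<in> N" by (force simp: N_def)+
    ultimately show "e \<in> preserved_edges G G' N (restrict f N)"
      using edge assms(3,4) by (auto simp: preserved_edges_def)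
  qed
  ultimately show ?thesis by (rule that)
qed

theorem theorem3p3:
  fixes G :: "('a, 'l) labeled_digraph" and G' :: "('b, 'l) labeled_digraph"
  assumes "simple_labeled_digraph G" and "simple_labeled_digraph G'"
  shows "aDMCES G G' = DMCES G G'"
proof (rule antisym)
  have fin: "finite U" if "(U, \<phi>) \<in> dmces_feasible G G'" for U \<phi>
    using that simple_labeled_digraphD(1)[OF assms(1)]
    by (auto simp: dmces_feasible_def intro: finite_subset)
  show "aDMCES G G' \<le> DMCES G G'"
    unfolding aDMCES_def
  proof (rule Max.boundedI[OF admces_sizes_finite_nonempty[OF assms(1)]])
    fix n
    assume "n \<in> {card W | W W'. W \<subseteq> edges G \<and> W' \<subseteq> edges G' \<and>
      labeled_digraph_isomorphic (edge_induced_subgraph G W) (edge_induced_subgraph G' W')}"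
    then obtain W W' where n: "n = card W" and W: "W \<subseteq> edges G" "W' \<subseteq> edges G'"
      "labeled_digraph_isomorphic (edge_induced_subgraph G W) (edge_induced_subgraph G' W')"
      by blast
    obtain U \<phi> where feas: "(U, \<phi>) \<in> dmces_feasible G G'" and sub: "W \<subseteq> preserved_edges G G' U \<phi>"
      using isomorphism_feasible[OF assms W] .
    \<comment> \<open>Monotonicity of \<open>card\<close> needs the larger set to be finite.\<close>
    have "finite (preserved_edges G G' U \<phi>)"
      using fin[OF feas] by (auto simp: preserved_edges_def intro: finite_subset[of _ "U \<times> U"])
    then have "n \<le> dmces_score G G' U \<phi>"
      using sub n by (simp add: dmces_score_eq_card_preserved_edges[OF fin[OF feas]] card_mono)
    also have "\<dots> \<le> DMCES G G'"
      unfolding DMCES_def using feas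
      by (intro Max_ge dmces_scores_finite_nonempty(1)[OF assms]) blast
    finally show "n \<le> DMCES G G'" .
  qed
  show "DMCES G G' \<le> aDMCES G G'"
    unfolding DMCES_def
  proof (rule Max.boundedI[OF dmces_scores_finite_nonempty[OF assms]])
    fix n
    assume "n \<in> {dmces_score G G' U \<phi> | U \<phi>. (U, \<phi>) \<in> dmces_feasible G G'}"
    then obtain U \<phi> where n: "n = dmces_score G G' U \<phi>" and feas: "(U, \<phi>) \<in> dmces_feasible G G'"
      by blast
    let ?W = "preserved_edges G G' U \<phi>"
    \<comment> \<open>The preserved edges and their image under \<open>\<phi>\<close> are an
      admissible pair for \<open>aDMCES\<close> whose size is exactly the score.\<close>
    have "?W \<subseteq> edges G" "map_prod \<phi> \<phi> ` ?W \<subseteq> edges G'"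
      by (auto simp: preserved_edges_def)
    then have "card ?W \<le> aDMCES G G'"
      unfolding aDMCES_def using preserved_edges_isomorphic_image[OF feas]
      by (intro Max_ge admces_sizes_finite_nonempty(1)[OF assms(1)]) blast
    then show "n \<le> aDMCES G G'"
      by (simp add: n dmces_score_eq_card_preserved_edges[OF fin[OF feas]])
  qed
qed

end
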